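(* Let $t:\mathbb{N}\to\mathbb{N}$ be a non-decreasing function with $\lim_{n\to\infty} n/t(n)=0$. Then the sequence $L^{(t)}$ is completely uniformly distributed.
   Context: Here $\mathbb{N}=\{1,2,3,\dots\}$. For integers $b,k\ge 1$, a $b$-ary de Bruijn sequence of order $k$ is a sequence of length $b^k$ over $\{0,1,\dots,b-1\}$ which, viewed as a cyclic sequence, contains every sequence of length $k$ over $\{0,\dots,b-1\}$ exactly once as a contiguous subsequence (including those wrapping around the end). The $b$-ary Ford sequence of order $k$, $F^{(b,k)}$, is the lexicographically least $b$-ary de Bruijn sequence of order $k$. For $n\in\mathbb{N}$, write $F^{(n,n)}=f_1,\dots,f_{n^n}$ and let $C^{(n)}$ be the finite sequence $f_1/n, f_2/n,\dots,f_{n^n}/n$. Let $D^{(n,t)}$ be the concatenation of $t(n)$ consecutive copies of $C^{(n)}$, and let $L^{(t)}$ be the infinite sequence obtained by concatenating $D^{(1,t)},D^{(2,t)},D^{(3,t)},\dots$ in this order. A sequence $(x_i)_{i\ge1}$ in $[0,1)$ is completely uniformly distributed if for every integer $k\ge1$ the sequence of vectors $(x_i,x_{i+1},\dots,x_{i+k-1})_{i\ge1}$ is uniformly distributed in $[0,1)^k$, i.e. for every box $I=[u_1,v_1)\times\dots\times[u_k,v_k)\subseteq[0,1)^k$, the proportion of indices $i\le N$ with $(x_i,\dots,x_{i+k-1})\in I$ tends to $\prod_d (v_d-u_d)$ as $N\to\infty$. *)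

theory Defs
  imports Complex_Main "HOL-Library.Stream"
begin

text \<open>The position of an occurrence is its starting index; reading indices modulo the length makes
  the sequence cyclic (and lets the pattern wrap around repeatedly, which happens for \<open>b = 1 < k\<close>).\<close>

definition occurs_cyclically_at :: "'a list \<Rightarrow> 'a list \<Rightarrow> nat \<Rightarrow> bool" where
  "occurs_cyclically_at v w i \<longleftrightarrow>
     i < length w \<and> (\<forall>j<length v. w ! ((i + j) mod length w) = v ! j)"

definition de_bruijn :: "nat \<Rightarrow> nat \<Rightarrow> nat list \<Rightarrow> bool" where
  "de_bruijn b k w \<longleftrightarrow>
     length w = b ^ k \<and> set w \<subseteq> {..<b} \<and>
     (\<forall>v. length v = k \<and> set v \<subseteq> {..<b} \<longrightarrow> (\<exists>!i. occurs_cyclically_at v w i))"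

definition ford :: "nat \<Rightarrow> nat \<Rightarrow> nat list" where
  "ford b k = (THE w. de_bruijn b k w \<and>
     (\<forall>w'. de_bruijn b k w' \<longrightarrow> w = w' \<or> (w, w') \<in> lexord less_than))"

definition C_seq :: "nat \<Rightarrow> real list" where
  "C_seq n = map (\<lambda>f. real f / real n) (ford n n)"

definition D_seq :: "(nat \<Rightarrow> nat) \<Rightarrow> nat \<Rightarrow> real list" where
  "D_seq t n = concat (replicate (t n) (C_seq n))"

text \<open>\<open>flat\<close> is the concatenation of a stream of lists provided that all of them are nonempty,
  as is the case here when \<open>t n \<ge> 1\<close> for all \<open>n \<ge> 1\<close>.\<close>

definition L_seq :: "(nat \<Rightarrow> nat) \<Rightarrow> real stream" where
  "L_seq t = flat (smap (D_seq t) (fromN 1))"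

text \<open>Infinite sequences are indexed from 0. A vector in \<open>[0,1)\<^sup>k\<close> is a function on \<open>nat\<close> of which
  only the values at \<open>d < k\<close> matter.\<close>

definition uniformly_distributed :: "nat \<Rightarrow> (nat \<Rightarrow> nat \<Rightarrow> real) \<Rightarrow> bool" where
  "uniformly_distributed k X \<longleftrightarrow>
     (\<forall>u v. (\<forall>d<k. 0 \<le> u d \<and> u d \<le> v d \<and> v d \<le> 1) \<longrightarrow>
       (\<lambda>N. real (card {i. i < N \<and> (\<forall>d<k. X i d \<in> {u d..<v d})}) / real N)
         \<longlonglongrightarrow> (\<Prod>d<k. v d - u d))"

definition completely_uniformly_distributed :: "(nat \<Rightarrow> real) \<Rightarrow> bool" where
  "completely_uniformly_distributed x \<longleftrightarrow>
     range x \<subseteq> {0..<1} \<and> (\<forall>k\<ge>1. uniformly_distributed k (\<lambda>i d. x (i + d)))"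

end

theory Submission
  imports Defs "HOL-Library.FuncSet"
begin

text \<open>Only the de Bruijn property of the Ford sequence matters. For \<open>k \<le> n\<close> every word of length \<open>k\<close>
  occurs cyclically in \<open>F\<^sup>(\<^sup>n\<^sup>,\<^sup>n\<^sup>)\<close> exactly \<open>n\<^sup>n\<^sup>-\<^sup>k\<close> times, so over each full copy of \<open>C\<^sup>(\<^sup>n\<^sup>)\<close> the
  frequency of a box is a product of grid densities, which tends to its volume as \<open>n \<rightarrow> \<infinity>\<close>. An
  initial segment of \<open>L\<^sup>(\<^sup>t\<^sup>)\<close> consists of full copies, except for the block boundaries, which cost \<open>k\<close>
  windows each, and one incomplete copy of length at most \<open>n\<^sup>n\<close>. As \<open>n\<^sup>n \<le> 2 e (n - 1) (n - 1)\<^sup>n\<^sup>-\<^sup>1\<close> and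
  \<open>n / t n \<rightarrow> 0\<close>, the latter is negligible compared to the preceding block.

  That a de Bruijn sequence exists at all is seen from a trail of maximal length that starts at the
  zero word and appends a zero only when nothing else is left (the idea of Martin's greedy
  algorithm).\<close>

subsection \<open>Existence of de Bruijn sequences\<close>

definition window :: "nat \<Rightarrow> 'a list \<Rightarrow> nat \<Rightarrow> 'a list" where
  "window k w i = take k (drop i w)"

lemma length_window: "i + k \<le> length w \<Longrightarrow> length (window k w i) = k"
  by (simp add: window_def)

lemma set_window_subset: "set (window k w i) \<subseteq> set w"
  unfolding window_def by (meson dual_order.trans set_drop_subset set_take_subset)

lemma nth_window: "i + k \<le> length w \<Longrightarrow> j < k \<Longrightarrow> window k w i ! j = w ! (i + j)"
  by (simp add: window_def)

lemma window_append: "i + k \<le> length w \<Longrightarrow> window k (w @ x) i = window k w i"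
  by (simp add: window_def)

lemma window_Suc_snoc:
  "i + k < length w \<Longrightarrow> window (Suc k) w i = window k w i @ [w ! (i + k)]"
  by (simp add: window_def take_Suc_conv_app_nth)

lemma window_Suc_Cons:
  "i < length w \<Longrightarrow> window (Suc k) w i = w ! i # window k w (Suc i)"
  by (simp add: window_def flip: Cons_nth_drop_Suc)

abbreviation words :: "nat \<Rightarrow> nat \<Rightarrow> nat list set" where
  "words b k \<equiv> {v. set v \<subseteq> {..<b} \<and> length v = k}"

text \<open>A trail in the graph with vertices \<open>words b n\<close> and edges \<open>words b (Suc n)\<close> that starts at
  \<open>0\<^sup>n\<close> and leaves a vertex along its \<open>0\<close>-edge only if all other edges out of it are used, too.\<close>

definition edges :: "nat \<Rightarrow> nat list \<Rightarrow> nat list set" where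
  "edges n w = window (Suc n) w ` {..<length w - n}"

definition trail :: "nat \<Rightarrow> nat \<Rightarrow> nat list \<Rightarrow> bool" where
  "trail b n w \<longleftrightarrow> set w \<subseteq> {..<b} \<and> n \<le> length w \<and> window n w 0 = replicate n 0 \<and>
     inj_on (window (Suc n) w) {..<length w - n} \<and>
     (\<forall>v. v @ [0] \<in> edges n w \<longrightarrow> (\<forall>c<b. v @ [c] \<in> edges n w))"

lemma edges_subset_words:
  assumes "set w \<subseteq> {..<b}"
  shows "edges n w \<subseteq> words b (Suc n)"
  using assms set_window_subset[of "Suc n" w]
  by (fastforce simp: edges_def length_window)

text \<open>The windows of length \<open>Suc n\<close> in a trail are distinct words, so there are
  at most \<open>b ^ Suc n\<close> of them. This makes a trail of maximal length available.\<close>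

lemma trail_length_le:
  assumes "trail b n w"
  shows "length w \<le> b ^ Suc n + n"
proof -
  have "card (edges n w) = length w - n"
    using assms by (simp add: edges_def trail_def card_image)
  moreover have "card (edges n w) \<le> card (words b (Suc n))"
    using assms by (intro card_mono edges_subset_words finite_lists_length_eq) (auto simp: trail_def)
  ultimately show ?thesis
    using card_lists_length_eq[of "{..<b}" "Suc n"] by simp
qed

lemma edges_snoc:
  assumes "n \<le> length w"
  shows "edges n (w @ [c]) = insert (window n w (length w - n) @ [c]) (edges n w)"
proof -
  have "{..<length (w @ [c]) - n} = insert (length w - n) {..<length w - n}"
    using assms by auto
  moreover have "window (Suc n) (w @ [c]) (length w - n) = window n w (length w - n) @ [c]"
    using assms by (simp add: window_Suc_snoc window_append)
  moreover have "window (Suc n) (w @ [c]) ` {..<length w - n} = edges n w"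
    unfolding edges_def by (intro image_cong) (auto simp: window_append)
  ultimately show ?thesis by (simp only: edges_def[of n "w @ [c]"] image_insert)
qed

lemma trail_extend:
  assumes w: "trail b n w" and c: "c < b" "window n w (length w - n) @ [c] \<notin> edges n w"
  obtains w' where "trail b n w'" "length w' = Suc (length w)"
proof -
  define u where "u = window n w (length w - n)"
  obtain d where d: "d < b" "u @ [d] \<notin> edges n w"
    and d0: "d = 0 \<Longrightarrow> \<forall>c<b. c \<noteq> 0 \<longrightarrow> u @ [c] \<in> edges n w"
    using c unfolding u_def by metis
  have len: "n \<le> length w" using w by (simp add: trail_def)
  have E: "edges n (w @ [d]) = insert (u @ [d]) (edges n w)"
    using edges_snoc[OF len] by (simp add: u_def)
  have dom: "{..<length (w @ [d]) - n} = insert (length w - n) {..<length w - n}"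
    using len by auto
  have old: "window (Suc n) (w @ [d]) i = window (Suc n) w i" if "i < length w - n" for i
    using that by (simp add: window_append)
  have new: "window (Suc n) (w @ [d]) (length w - n) = u @ [d]"
    using len by (simp add: window_Suc_snoc window_append u_def)
  have "inj_on (window (Suc n) (w @ [d])) {..<length w - n}"
    using w old by (subst inj_on_cong[where g = "window (Suc n) w"]) (auto simp: trail_def)
  moreover have "u @ [d] \<notin> window (Suc n) (w @ [d]) ` {..<length w - n}"
    using d(2) old by (auto simp: edges_def)
  ultimately have inj: "inj_on (window (Suc n) (w @ [d])) {..<length (w @ [d]) - n}"
    unfolding dom by (simp add: new)
  have "trail b n (w @ [d])"
    unfolding trail_def
  proof (intro conjI allI impI)
    show "window n (w @ [d]) 0 = replicate n 0"
      using w len by (simp add: trail_def window_append)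
    fix v c assume "v @ [0] \<in> edges n (w @ [d])" "c < b"
    then show "v @ [c] \<in> edges n (w @ [d])"
      using w d0 unfolding E trail_def by (cases "c = 0") auto
  qed (use w d inj in \<open>auto simp: trail_def\<close>)
  then show ?thesis using that by simp
qed

section \<open>Counting arrivals and departures along a trail\<close>

definition visits :: "nat \<Rightarrow> nat list \<Rightarrow> nat list \<Rightarrow> nat set" where
  "visits n w v = {i. i \<le> length w - n \<and> window n w i = v}"

lemma finite_visits: "finite (visits n w v)"
  by (simp add: visits_def)

text \<open>Every visit to \<open>v\<close> except one at the final position is a departure along
  the edge labelled \<open>w ! (i + n)\<close>, and \<open>b\<close> different edges need
  \<open>b\<close> departures.\<close>

lemma card_visits_out:
  assumes "\<forall>c<b. v @ [c] \<in> edges n w"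
  shows "b \<le> card (visits n w v - {length w - n})"
proof -
  have "{..<b} \<subseteq> (\<lambda>i. w ! (i + n)) ` (visits n w v - {length w - n})"
  proof
    fix c assume "c \<in> {..<b}"
    then obtain i where i: "i < length w - n" "v @ [c] = window (Suc n) w i"
      using assms by (auto simp: edges_def)
    then have "window n w i = v" "w ! (i + n) = c"
      by (auto simp: window_Suc_snoc)
    then show "c \<in> (\<lambda>i. w ! (i + n)) ` (visits n w v - {length w - n})"
      using i by (auto simp: visits_def)
  qed
  from surj_card_le[OF _ this] show ?thesis
    by (simp add: finite_visits)
qed

text \<open>Every visit except one at position \<open>0\<close> is an arrival along
  \<open>w ! (i - 1) # v\<close>. Different arrivals use different edges because a trail repeats
  none.\<close>

lemma visits_in:
  assumes "trail b n w"
  shows "inj_on (\<lambda>i. w ! (i - 1)) (visits n w v - {0})"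
    and "(\<lambda>i. w ! (i - 1)) ` (visits n w v - {0}) \<subseteq> {a. a < b \<and> a # v \<in> edges n w}"
proof -
  have len: "n \<le> length w" using assms by (simp add: trail_def)
  have win: "window (Suc n) w (i - 1) = w ! (i - 1) # v" "i - 1 < length w - n"
    if "i \<in> visits n w v - {0}" for i
    using that len window_Suc_Cons[of "i - 1" w n] by (auto simp: visits_def)
  show "inj_on (\<lambda>i. w ! (i - 1)) (visits n w v - {0})"
  proof (rule inj_onI)
    fix i j assume *: "i \<in> visits n w v - {0}" "j \<in> visits n w v - {0}" "w ! (i - 1) = w ! (j - 1)"
    then have "window (Suc n) w (i - 1) = window (Suc n) w (j - 1)"
      by (simp only: win)
    then have "i - 1 = j - 1"
      using assms win(2)[OF *(1)] win(2)[OF *(2)] by (auto simp: trail_def dest: inj_onD)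
    moreover have "0 < i" "0 < j" using * by auto
    ultimately show "i = j" by linarith
  qed
  show "(\<lambda>i. w ! (i - 1)) ` (visits n w v - {0}) \<subseteq> {a. a < b \<and> a # v \<in> edges n w}"
  proof (rule image_subsetI)
    fix i assume i: "i \<in> visits n w v - {0}"
    have "w ! (i - 1) \<in> set w" using win(2)[OF i] by simp
    moreover have "w ! (i - 1) # v \<in> edges n w"
      unfolding edges_def using win[OF i] by (intro image_eqI[of _ _ "i - 1"]) auto
    ultimately show "w ! (i - 1) \<in> {a. a < b \<and> a # v \<in> edges n w}"
      using assms by (auto simp: trail_def)
  qed
qed

lemma card_visits_in_le:
  assumes "trail b n w"
  shows "card (visits n w v - {0}) \<le> b"
proof -
  have "(\<lambda>i. w ! (i - 1)) ` (visits n w v - {0}) \<subseteq> {..<b}"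
    using visits_in(2)[OF assms, of v] by auto
  from card_inj_on_le[OF visits_in(1)[OF assms] this] show ?thesis by simp
qed

text \<open>If the final vertex were not the initial one, arrivals there would exceed departures by
  one. With all \<open>b\<close> outgoing edges used, this gives more than \<open>b\<close>
  arrivals, but only \<open>b\<close> edges come in.\<close>

lemma stuck_trail_closed:
  assumes w: "trail b n w" and out: "\<forall>c<b. window n w (length w - n) @ [c] \<in> edges n w"
  shows "window n w (length w - n) = replicate n 0"
proof (rule ccontr)
  define u where "u = window n w (length w - n)"
  assume "window n w (length w - n) \<noteq> replicate n 0"
  then have "0 \<notin> visits n w u"
    using w by (auto simp: visits_def u_def trail_def)
  moreover have "length w - n \<in> visits n w u" by (simp add: visits_def u_def)
  moreover have "b \<le> card (visits n w u - {length w - n})"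
    using card_visits_out out by (simp add: u_def)
  moreover have "card (visits n w u - {0}) \<le> b"
    by (rule card_visits_in_le[OF w])
  ultimately show False
    using card_Suc_Diff1[OF finite_visits, of "length w - n" n w u] by simp
qed

text \<open>On a closed trail each vertex has as many arrivals as departures, so \<open>b\<close>
  departures force all \<open>b\<close> incoming edges to be used.\<close>

lemma closed_trail_in_full:
  assumes w: "trail b n w" and closed: "window n w (length w - n) = replicate n 0"
    and out: "\<forall>c<b. v @ [c] \<in> edges n w" and a: "a < b"
  shows "a # v \<in> edges n w"
proof -
  have "0 \<in> visits n w v \<longleftrightarrow> length w - n \<in> visits n w v"
    using w closed by (auto simp: visits_def trail_def)
  then have "card (visits n w v - {0}) = card (visits n w v - {length w - n})"
    by (simp add: card_Diff_singleton_if)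
  then have "b \<le> card (visits n w v - {0})"
    using card_visits_out[OF out] by simp
  also have "\<dots> = card ((\<lambda>i. w ! (i - 1)) ` (visits n w v - {0}))"
    using visits_in(1)[OF w] by (simp add: card_image)
  finally have "b \<le> card ((\<lambda>i. w ! (i - 1)) ` (visits n w v - {0}))" .
  moreover have sub: "(\<lambda>i. w ! (i - 1)) ` (visits n w v - {0}) \<subseteq> {..<b}"
    using visits_in(2)[OF w, of v] by auto
  ultimately have "(\<lambda>i. w ! (i - 1)) ` (visits n w v - {0}) = {..<b}"
    by (intro card_subset_eq) (auto intro: antisym card_mono[OF _ sub, simplified])
  then show ?thesis
    using visits_in(2)[OF w, of v] a by auto
qed

text \<open>Going backwards along \<open>0\<close>-edges reaches every vertex from \<open>0\<^sup>n\<close>, and a vertex all of whose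
  incoming edges are used passes this property to its predecessors along \<open>0\<close>-edges.\<close>

lemma closed_trail_complete:
  assumes w: "trail b n w" and b: "b \<ge> 1"
    and out: "\<forall>c<b. window n w (length w - n) @ [c] \<in> edges n w"
  shows "edges n w = words b (Suc n)"
proof -
  note closed = stuck_trail_closed[OF w out]
  note in_full = closed_trail_in_full[OF w closed]
  have *: "a # x @ replicate (n - length x) 0 \<in> edges n w"
    if "length x \<le> n" "set x \<subseteq> {..<b}" "a < b" for a x
    using that
  proof (induction x arbitrary: a)
    case Nil
    \<comment> \<open>The vertex is \<open>0^n\<close>, where the trail is stuck, so all edges out
      of it are used.\<close>
    then show ?case using in_full[of "replicate n 0" a] out closed by simp
  next
    case (Cons y ys)
    then have "n - length ys = Suc (n - length (y # ys))" by simp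
    \<comment> \<open>Since \<open>ys\<close> is shorter than \<open>n\<close>, the edge from the
      induction hypothesis ends in \<open>0\<close>: it is the \<open>0\<close>-edge out of the
      vertex \<open>y # ys\<close> padded with zeros. By the last clause of \<open>trail\<close>,
      all edges out of that vertex are used.\<close>
    then have "replicate (n - length ys) (0::nat) = replicate (n - length (y # ys)) 0 @ [0]"
      by (metis replicate_Suc replicate_append_same)
    moreover have "y # ys @ replicate (n - length ys) 0 \<in> edges n w"
      using Cons by simp
    ultimately have "((y # ys) @ replicate (n - length (y # ys)) 0) @ [0] \<in> edges n w"
      by simp
    then have "\<forall>c<b. ((y # ys) @ replicate (n - length (y # ys)) 0) @ [c] \<in> edges n w"
      using w unfolding trail_def by blast
    from in_full[OF this] Cons.prems show ?case by simp
  qed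
  show ?thesis
  proof
    show "edges n w \<subseteq> words b (Suc n)"
      using w by (intro edges_subset_words) (simp add: trail_def)
    show "words b (Suc n) \<subseteq> edges n w"
    proof
      fix v assume "v \<in> words b (Suc n)"
      then obtain a x where "v = a # x" "length x = n" "set x \<subseteq> {..<b}" "a < b"
        by (cases v) auto
      then show "v \<in> edges n w" using *[of x a] by simp
    qed
  qed
qed

section \<open>From complete closed trails to cyclic words\<close>

text \<open>The word \<open>w\<close> has length \<open>b ^ Suc n + n\<close> and both starts and
  ends with \<open>0^n\<close>. Cutting off the last \<open>n\<close> letters leaves a word whose
  cyclic windows are exactly the windows of \<open>w\<close>.\<close>

lemma de_bruijn_of_closed_trail:
  assumes w: "trail b n w" and b: "b \<ge> 1"
    and closed: "window n w (length w - n) = replicate n 0"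
    and complete: "edges n w = words b (Suc n)"
  shows "de_bruijn b (Suc n) (take (b ^ Suc n) w)"
proof -
  define L where "L = b ^ Suc n"
  define c where "c = take L w"
  have n: "n \<le> length w" and wb: "set w \<subseteq> {..<b}" using w by (auto simp: trail_def)
  have "card (edges n w) = length w - n"
    using w by (simp add: edges_def trail_def card_image)
  then have lw: "length w = L + n"
    using n card_lists_length_eq[of "{..<b}" "Suc n"] by (simp add: complete L_def)
  then have lc: "length c = L" by (simp add: c_def)
  have L0: "L > 0" using b by (simp add: L_def)
  have wc: "c ! ((i + j) mod L) = w ! (i + j)" if "i < L" "j < Suc n" for i j
  proof (cases "i + j < L")
    case True
    then show ?thesis by (simp add: c_def)
  next
    case False
    define r where "r = i + j - L"
    have r: "i + j = L + r" "r < n" using False that by (auto simp: r_def)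
    have end0: "w ! (i + j) = 0"
      using nth_window[of L n w r] closed r lw by simp
    \<comment> \<open>For \<open>b = 1\<close> the length \<open>L\<close> is \<open>1\<close> and
      an index may wrap around repeatedly, but every letter is \<open>0\<close>. For
      \<open>b \<ge> 2\<close> one has \<open>n < L\<close>, so it wraps only once.\<close>
    show ?thesis
    proof (cases "b = 1")
      case True
      have "c ! ((i + j) mod L) \<in> set c" using L0 lc by simp
      then show ?thesis using wb True set_take_subset[of L w] end0 by (auto simp: c_def)
    next
      case False
      have "n < 2 ^ n" by (rule less_exp)
      also have "\<dots> \<le> b ^ n" using b False by (intro power_mono) auto
      also have "\<dots> \<le> L" unfolding L_def using b by (intro power_increasing) auto
      finally have "r < L" using r by simp
      moreover have "w ! r = 0"
        using nth_window[of 0 n w r] w r lw by (simp add: trail_def)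
      ultimately show ?thesis using end0 r by (simp add: c_def)
    qed
  qed
  have occ: "occurs_cyclically_at v c i \<longleftrightarrow> i < length w - n \<and> window (Suc n) w i = v"
    if v: "length v = Suc n" for v i
  proof -
    have "window (Suc n) w i = v \<longleftrightarrow> (\<forall>j<Suc n. w ! (i + j) = v ! j)" if "i < L"
      using that lw v nth_window[of i "Suc n" w] length_window[of i "Suc n" w]
      by (auto simp: list_eq_iff_nth_eq)
    then show ?thesis
      using wc lw v by (auto simp: occurs_cyclically_at_def lc)
  qed
  have "\<exists>!i. occurs_cyclically_at v c i" if v: "length v = Suc n" "set v \<subseteq> {..<b}" for v
  proof -
    have "v \<in> edges n w" using v complete by simp
    moreover have "inj_on (window (Suc n) w) {..<length w - n}" using w by (simp add: trail_def)
    ultimately show ?thesis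
      unfolding occ[OF v(1)] edges_def by (auto dest: inj_onD)
  qed
  then show ?thesis
    using lc wb set_take_subset[of L w] unfolding de_bruijn_def L_def[symmetric] c_def[symmetric]
    by (auto simp: c_def)
qed

theorem de_bruijn_exists:
  assumes "b \<ge> 1" "k \<ge> 1"
  shows "\<exists>w. de_bruijn b k w"
proof -
  obtain n where k: "k = Suc n" using assms by (cases k) auto
  have "trail b n (replicate n 0)"
    using assms by (auto simp: trail_def window_def edges_def)
  then obtain w where w: "trail b n w" "\<forall>w'. trail b n w' \<longrightarrow> length w' \<le> length w"
    using ex_has_greatest_nat[of "trail b n" "replicate n 0" length "Suc (b ^ Suc n + n)"]
    by (metis trail_length_le less_Suc_eq_le)
  have out: "\<forall>c<b. window n w (length w - n) @ [c] \<in> edges n w"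
  proof (rule ccontr)
    assume "\<not> ?thesis"
    then obtain w' where "trail b n w'" "length w' = Suc (length w)"
      using trail_extend[OF w(1)] by metis
    then show False using w(2) by force
  qed
  show ?thesis
    using de_bruijn_of_closed_trail[OF w(1) assms(1) stuck_trail_closed[OF w(1) out]
        closed_trail_complete[OF w(1) assms(1) out]] k by blast
qed

text \<open>Shows that the definite description is proper. As \<open>lexord\<close> is not
  well-founded, a minimal element is taken for \<open>lex\<close>, which compares lists of equal
  length only; all de Bruijn sequences for given \<open>b\<close> and \<open>k\<close> have the same
  length.\<close>

lemma de_bruijn_ford:
  assumes "b \<ge> 1" "k \<ge> 1"
  shows "de_bruijn b k (ford b k)"
proof -
  let ?P = "\<lambda>w. de_bruijn b k w \<and> (\<forall>w'. de_bruijn b k w' \<longrightarrow> w = w' \<or> (w, w') \<in> lexord less_than)"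
  obtain w where w: "de_bruijn b k w" "\<And>w'. (w', w) \<in> lex less_than \<Longrightarrow> \<not> de_bruijn b k w'"
    using de_bruijn_exists[OF assms] wfE_min[OF wf_lex[OF wf_less_than], of _ "Collect (de_bruijn b k)"]
    by (metis mem_Collect_eq)
  have "?P w"
  proof (intro conjI allI impI)
    fix w' assume w': "de_bruijn b k w'"
    then have "length w' = length w" using w by (simp add: de_bruijn_def)
    then have "(w', w) \<notin> lexord less_than" using w w' by (auto simp: lexord_lex)
    then show "w = w' \<or> (w, w') \<in> lexord less_than"
      using lexord_linear[of less_than w w'] less_linear by auto
  qed (rule w)
  moreover have "v = w" if "?P v" for v
  proof (rule ccontr)
    assume "v \<noteq> w"
    then have "(v, w) \<in> lexord less_than" "(w, v) \<in> lexord less_than"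
      using that \<open>?P w\<close> by blast+
    then have "(w, w) \<in> lexord less_than"
      using lexord_trans[of w v less_than w] by (simp add: trans_def)
    then show False using lexord_irreflexive[of less_than w] by simp
  qed
  ultimately show ?thesis
    unfolding ford_def by (rule theI2[of ?P]) auto
qed

subsection \<open>Frequencies of windows\<close>

text \<open>Reading off the cyclic window of length \<open>n\<close> is a bijection from positions
  to all words of length \<open>n\<close>. Constraining the first \<open>k\<close> letters leaves
  \<open>n - k\<close> letters free. Windows are encoded as extensional functions so that the count
  is the size of a \<open>PiE\<close>.\<close>

lemma card_de_bruijn_windows:
  assumes w: "de_bruijn b n w" and k: "k \<le> n" and A: "\<And>d. d < k \<Longrightarrow> A d \<subseteq> {..<b}"
  shows "card {i. i < b ^ n \<and> (\<forall>d<k. w ! ((i + d) mod b ^ n) \<in> A d)} =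
    (\<Prod>d<k. card (A d)) * b ^ (n - k)"
proof -
  define L where "L = b ^ n"
  define f where "f i = (\<lambda>j\<in>{..<n}. w ! ((i + j) mod L))" for i
  define B where "B d = (if d < k then A d else {..<b})" for d
  have lw: "length w = L" and wb: "set w \<subseteq> {..<b}"
    and ex1: "\<And>v. length v = n \<Longrightarrow> set v \<subseteq> {..<b} \<Longrightarrow> \<exists>!i. occurs_cyclically_at v w i"
    using w by (auto simp: de_bruijn_def L_def)
  have occ: "occurs_cyclically_at (map g [0..<n]) w i \<longleftrightarrow> i < L \<and> (\<forall>j<n. f i j = g j)" for g i
    by (auto simp: occurs_cyclically_at_def lw f_def)
  have wj: "w ! (j mod L) < b" if "i < L" for i j
  proof -
    have "j mod L < length w" using that lw by simp
    from nth_mem[OF this] show ?thesis using wb by auto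
  qed
  have inj: "inj_on f {..<L}"
  proof (rule inj_onI)
    fix i i' assume *: "i \<in> {..<L}" "i' \<in> {..<L}" "f i = f i'"
    have "set (map (f i) [0..<n]) \<subseteq> {..<b}" using * wj by (auto simp: f_def)
    then have "\<exists>!j. occurs_cyclically_at (map (f i) [0..<n]) w j" by (intro ex1) auto
    moreover have "occurs_cyclically_at (map (f i) [0..<n]) w i"
      "occurs_cyclically_at (map (f i) [0..<n]) w i'"
      using * by (auto simp: occ)
    ultimately show "i = i'" by blast
  qed
  have "f ` {i. i < L \<and> (\<forall>d<k. w ! ((i + d) mod L) \<in> A d)} = PiE {..<n} B"
  proof (intro equalityI subsetI)
    fix g assume "g \<in> f ` {i. i < L \<and> (\<forall>d<k. w ! ((i + d) mod L) \<in> A d)}"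
    then show "g \<in> PiE {..<n} B" using k wj by (auto simp: f_def B_def split: if_splits)
  next
    fix g assume g: "g \<in> PiE {..<n} B"
    then have gb: "g j < b" if "j < n" for j
      using that A PiE_mem[OF g, of j] by (auto simp: B_def split: if_splits)
    then have "set (map g [0..<n]) \<subseteq> {..<b}" by auto
    then obtain i where "occurs_cyclically_at (map g [0..<n]) w i"
      using ex1[of "map g [0..<n]"] by (metis length_map diff_zero length_upt)
    then have i: "i < L" "\<And>j. j < n \<Longrightarrow> f i j = g j" by (auto simp: occ)
    have "f i = g"
      using g i by (intro extensionalityI[of _ "{..<n}"]) (auto simp: f_def PiE_def)
    moreover have "w ! ((i + d) mod L) \<in> A d" if "d < k" for d
      using that k PiE_mem[OF g, of d] i(2)[of d] by (simp add: B_def f_def)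
    ultimately show "g \<in> f ` {i. i < L \<and> (\<forall>d<k. w ! ((i + d) mod L) \<in> A d)}"
      using i(1) by blast
  qed
  moreover have "inj_on f {i. i < L \<and> (\<forall>d<k. w ! ((i + d) mod L) \<in> A d)}"
    by (rule inj_on_subset[OF inj]) auto
  ultimately have "card {i. i < L \<and> (\<forall>d<k. w ! ((i + d) mod L) \<in> A d)} = card (PiE {..<n} B)"
    by (simp only: card_image[symmetric])
  also have "\<dots> = (\<Prod>d<n. card (B d))" by (simp add: card_PiE)
  also have "{..<n} = {..<k} \<union> {k..<n}" using k by auto
  also have "(\<Prod>d\<in>{..<k} \<union> {k..<n}. card (B d)) = (\<Prod>d<k. card (A d)) * b ^ (n - k)"
    by (subst prod.union_disjoint) (auto simp: B_def)
  finally show ?thesis by (simp add: L_def)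
qed

section \<open>Frequency of a box in one copy of \<open>C_seq\<close>\<close>

text \<open>The interval contains \<open>\<lceil>n * v\<rceil> - \<lceil>n * u\<rceil>\<close>
  points of the grid of mesh \<open>1 / n\<close>, which differs from \<open>n * (v - u)\<close> by
  at most \<open>1\<close>.\<close>

lemma grid_density:
  fixes u v :: real
  assumes "0 \<le> u" "u \<le> v" "v \<le> 1"
  shows "(\<lambda>n. real (card {a. a < n \<and> real a / real n \<in> {u..<v}}) / real n) \<longlonglongrightarrow> v - u"
proof -
  define G where "G n = card {a. a < n \<and> real a / real n \<in> {u..<v}}" for n
  have bound: "norm (real (G n) / real n - (v - u)) \<le> 1 / real n"
    if n: "n \<ge> 1" for n
  proof -
    have iff: "a < n \<and> real a / real n \<in> {u..<v} \<longleftrightarrow> nat \<lceil>n * u\<rceil> \<le> a \<and> a < nat \<lceil>n * v\<rceil>" for a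
    proof -
      have "real a < n" if "real a < n * v"
        using mult_left_mono[OF assms(3), of "real n"] that by linarith
      moreover have "a < nat \<lceil>n * v\<rceil> \<longleftrightarrow> real a < n * v"
        by (metis linorder_not_less nat_ceiling_le_eq)
      ultimately show ?thesis
        using n by (auto simp: nat_ceiling_le_eq field_simps)
    qed
    have "{a. a < n \<and> real a / real n \<in> {u..<v}} = {nat \<lceil>n * u\<rceil>..<nat \<lceil>n * v\<rceil>}"
      unfolding iff by auto
    moreover have "nat \<lceil>n * u\<rceil> \<le> nat \<lceil>n * v\<rceil>"
      using assms by (intro nat_mono ceiling_mono mult_left_mono) auto
    moreover have "real (nat \<lceil>n * x\<rceil>) = of_int \<lceil>n * x\<rceil>" if "0 \<le> x" for x :: real
      using that mult_nonneg_nonneg[of "real n" x] by simp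
    ultimately have "real (G n) = of_int \<lceil>n * v\<rceil> - of_int \<lceil>n * u\<rceil>"
      using assms by (simp add: of_nat_diff G_def)
    then have "\<bar>real (G n) - n * (v - u)\<bar> \<le> 1"
      using ceiling_correct[of "n * u"] ceiling_correct[of "n * v"]
      unfolding right_diff_distrib by linarith
    then have "\<bar>(real (G n) - n * (v - u)) / n\<bar> \<le> 1 / n"
      using n by (simp add: divide_right_mono)
    moreover have "(real (G n) - n * (v - u)) / n = real (G n) / n - (v - u)"
      using n by (simp add: diff_divide_distrib)
    ultimately show ?thesis by simp
  qed
  have "(\<lambda>n. real (G n) / real n - (v - u)) \<longlonglongrightarrow> 0"
    by (rule tendsto_0_le[where K = 1, OF lim_1_over_n[where 'a = real]]) (use bound in \<open>auto intro: eventually_sequentiallyI[of 1]\<close>)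
  then show ?thesis by (simp add: LIM_zero_iff G_def)
qed

lemma length_C_seq: "n \<ge> 1 \<Longrightarrow> length (C_seq n) = n ^ n"
  using de_bruijn_ford[of n n] by (simp add: C_seq_def de_bruijn_def)

text \<open>For \<open>n \<ge> k\<close> the frequency is exactly the product of the one-dimensional
  grid densities.\<close>

lemma C_seq_density:
  assumes uv: "\<forall>d<k. 0 \<le> u d \<and> u d \<le> v d \<and> v d \<le> 1"
  shows "(\<lambda>n. real (card {i. i < n ^ n \<and> (\<forall>d<k. C_seq n ! ((i + d) mod n ^ n) \<in> {u d..<v d})}) / real (n ^ n))
    \<longlonglongrightarrow> (\<Prod>d<k. v d - u d)"
proof -
  define A where "A n d = {a. a < n \<and> real a / real n \<in> {u d..<v d}}" for n d
  have eq: "real (card {i. i < n ^ n \<and> (\<forall>d<k. C_seq n ! ((i + d) mod n ^ n) \<in> {u d..<v d})}) / real (n ^ n)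
    = (\<Prod>d<k. real (card (A n d)) / real n)" if n: "n \<ge> max 1 k" for n
  proof -
    have db: "de_bruijn n n (ford n n)" using n by (intro de_bruijn_ford) auto
    then have lf: "length (ford n n) = n ^ n" and sf: "set (ford n n) \<subseteq> {..<n}"
      by (auto simp: de_bruijn_def)
    have n0: "n ^ n > 0" using n by simp
    have "C_seq n ! (i mod n ^ n) \<in> {u d..<v d} \<longleftrightarrow> ford n n ! (i mod n ^ n) \<in> A n d" for i d
    proof -
      have "ford n n ! (i mod n ^ n) < n"
        using sf lf n0 nth_mem[of "i mod n ^ n" "ford n n"] by fastforce
      then show ?thesis using lf n0 by (simp add: C_seq_def A_def)
    qed
    then have "card {i. i < n ^ n \<and> (\<forall>d<k. C_seq n ! ((i + d) mod n ^ n) \<in> {u d..<v d})}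
      = (\<Prod>d<k. card (A n d)) * n ^ (n - k)"
      using card_de_bruijn_windows[OF db, of k "A n"] n by (auto simp: A_def)
    moreover have "real n ^ n = real n ^ k * real n ^ (n - k)"
      using n by (simp flip: power_add)
    ultimately show ?thesis
      using n by (simp add: prod_dividef)
  qed
  have lim: "(\<lambda>n. \<Prod>d<k. real (card (A n d)) / real n) \<longlonglongrightarrow> (\<Prod>d<k. v d - u d)"
    unfolding A_def using uv by (intro tendsto_prod grid_density) auto
  have "\<forall>\<^sub>F n in sequentially. (\<Prod>d<k. real (card (A n d)) / real n) =
    real (card {i. i < n ^ n \<and> (\<forall>d<k. C_seq n ! ((i + d) mod n ^ n) \<in> {u d..<v d})}) / real (n ^ n)"
    by (rule eventually_sequentiallyI[of "max 1 k"]) (simp only: eq)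
  with lim show ?thesis by (rule Lim_transform_eventually)
qed

subsection \<open>The blocks of the concatenation\<close>

lemma flat_snth_block:
  assumes "\<forall>xs\<in>sset s. xs \<noteq> []" "j < length (s !! m)"
  shows "flat s !! ((\<Sum>i<m. length (s !! i)) + j) = (s !! m) ! j"
  using assms
proof (induction m arbitrary: s)
  case 0
  then show ?case by (simp add: flat_snth)
next
  case (Suc m)
  have "\<forall>xs\<in>sset (stl s). xs \<noteq> []" using Suc.prems(1) by (auto dest: stl_sset)
  from Suc.IH[OF this] Suc.prems show ?case
    by (subst flat_snth) (simp_all add: sum.lessThan_Suc_shift del: sum.lessThan_Suc)
qed

lemma length_concat_replicate: "length (concat (replicate q xs)) = q * length xs"
  by (induction q) auto

lemma nth_concat_replicate:
  "j < q * length xs \<Longrightarrow> concat (replicate q xs) ! j = xs ! (j mod length xs)"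
  by (induction q arbitrary: j) (auto simp: nth_append le_mod_geq)

text \<open>The index in \<open>L_seq t\<close> at which the block \<open>D_seq t (Suc m)\<close>
  starts; blocks are numbered from \<open>0\<close> here, while their parameter starts at
  \<open>1\<close>.\<close>

definition offset :: "(nat \<Rightarrow> nat) \<Rightarrow> nat \<Rightarrow> nat" where
  "offset t m = (\<Sum>i<m. t (Suc i) * Suc i ^ Suc i)"

lemma offset_Suc: "offset t (Suc m) = offset t m + t (Suc m) * Suc m ^ Suc m"
  by (simp add: offset_def)

lemma L_seq_snth:
  assumes t: "\<And>n. n \<ge> 1 \<Longrightarrow> t n \<ge> 1" and j: "j < t (Suc m) * Suc m ^ Suc m"
  shows "L_seq t !! (offset t m + j) = C_seq (Suc m) ! (j mod Suc m ^ Suc m)"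
proof -
  let ?s = "smap (D_seq t) (fromN 1)"
  have len: "length (D_seq t n) = t n * n ^ n" if "n \<ge> 1" for n
    using that by (simp add: D_seq_def length_concat_replicate length_C_seq)
  have snth: "?s !! i = D_seq t (Suc i)" for i
    by (simp add: snth_siterate)
  \<comment> \<open>\<open>t n \<ge> 1\<close> makes every block nonempty, as \<open>flat\<close>
    requires.\<close>
  have ne: "\<forall>xs\<in>sset ?s. xs \<noteq> []"
  proof
    fix xs assume "xs \<in> sset ?s"
    then obtain n where "n \<ge> 1" "xs = D_seq t n" by (auto simp: stream.set_map)
    then have "length xs > 0" using len[of n] t[of n] by simp
    then show "xs \<noteq> []" by simp
  qed
  have "j < length (?s !! m)" using j len[of "Suc m"] by (simp only: snth)
  from flat_snth_block[OF ne this] have "L_seq t !! (offset t m + j) = D_seq t (Suc m) ! j"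
    unfolding snth by (simp add: L_seq_def offset_def len)
  also have "\<dots> = C_seq (Suc m) ! (j mod Suc m ^ Suc m)"
    using j nth_concat_replicate[of j "t (Suc m)" "C_seq (Suc m)"] length_C_seq[of "Suc m"]
    by (simp add: D_seq_def)
  finally show ?thesis .
qed

text \<open>Used to find the block that contains a given index.\<close>

lemma between_consecutive:
  fixes f :: "nat \<Rightarrow> nat"
  assumes "\<And>m. f m < f (Suc m)" "f 0 \<le> n"
  obtains m where "f m \<le> n" "n < f (Suc m)"
proof -
  have "strict_mono f" using assms(1) by (simp add: strict_mono_Suc_iff)
  then have "n < f (Suc n)" using seq_suble[of f "Suc n"] by simp
  then have *: "n < f (LEAST m. n < f m)" by (rule LeastI)
  then obtain m where m: "(LEAST m. n < f m) = Suc m"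
    using assms(2) by (cases "LEAST m. n < f m") auto
  have "f m \<le> n" using not_less_Least[of m "\<lambda>m. n < f m"] m by simp
  with * m show ?thesis using that by simp
qed

subsection \<open>Discrepancy\<close>

text \<open>Writes the discrepancy as a sum of centred indicators, so that it can be split along
  blocks.\<close>

lemma sum_of_bool_minus:
  "(\<Sum>i<N. of_bool (P i) - \<Lambda>) = real (card {i. i < N \<and> P i}) - \<Lambda> * real N"
proof -
  have "(\<Sum>i<N. of_bool (P i) :: real) = real (card ({..<N} \<inter> {i. P i}))"
    by (simp add: sum_of_bool_eq)
  also have "{..<N} \<inter> {i. P i} = {i. i < N \<and> P i}" by auto
  finally show ?thesis by (simp add: sum_subtractf)
qed

lemma sum_periodic:
  fixes f :: "nat \<Rightarrow> real"
  shows "(\<Sum>i<q * L. f (i mod L)) = real q * (\<Sum>i<L. f i)"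
proof (induction q)
  case (Suc q)
  have "(\<Sum>i<Suc q * L. f (i mod L)) = (\<Sum>i<q * L. f (i mod L)) + (\<Sum>i<L. f ((q * L + i) mod L))"
    using sum.nat_group[of "\<lambda>i. f (i mod L)" L "Suc q"] sum.nat_group[of "\<lambda>i. f (i mod L)" L q]
      sum.shift_bounds_nat_ivl[of "\<lambda>i. f (i mod L)" 0 "q * L" L]
    by (simp add: atLeast0LessThan add.commute)
  then show ?case using Suc by (simp add: algebra_simps)
qed simp

text \<open>Windows of length \<open>k\<close> starting among the last \<open>k\<close> positions of a block may leave the block.\<close>

lemma block_discrepancy:
  fixes \<Lambda> :: real
  assumes PQ: "\<And>i. i + k \<le> T \<Longrightarrow> P i = Q (i mod L)" and \<Lambda>: "0 \<le> \<Lambda>" "\<Lambda> \<le> 1"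
    and le: "q * L + r \<le> T"
  shows "\<bar>\<Sum>i<q * L + r. of_bool (P i) - \<Lambda>\<bar>
    \<le> real q * \<bar>real (card {i. i < L \<and> Q i}) - \<Lambda> * real L\<bar> + real k + real r"
proof -
  define g h :: "nat \<Rightarrow> real" where
    "g i = of_bool (P i) - \<Lambda>" and "h i = of_bool (Q i) - \<Lambda>" for i
  \<comment> \<open>Replacing actual windows by cyclic ones changes a summand by at most
    \<open>1\<close>, and only where the window leaves the block.\<close>
  have "(\<Sum>i<q * L. \<bar>g i - h (i mod L)\<bar>) \<le> (\<Sum>i<q * L. of_bool (T < i + k))"
    using PQ by (intro sum_mono) (auto simp: g_def h_def not_less)
  also have "\<dots> = real (card ({..<q * L} \<inter> {i. T < i + k}))"
    by (simp add: sum_of_bool_eq)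
  also have "\<dots> \<le> real (card {T - k..<T})"
    using le by (intro of_nat_mono card_mono) auto
  also have "\<dots> \<le> real k" by simp
  finally have 1: "\<bar>\<Sum>i<q * L. g i - h (i mod L)\<bar> \<le> real k"
    using sum_abs[of "\<lambda>i. g i - h (i mod L)" "{..<q * L}"] by linarith
  have "(\<Sum>i\<in>{q * L..<q * L + r}. \<bar>g i\<bar>) \<le> (\<Sum>i\<in>{q * L..<q * L + r}. 1)"
    using \<Lambda> by (intro sum_mono) (auto simp: g_def)
  then have 2: "\<bar>\<Sum>i\<in>{q * L..<q * L + r}. g i\<bar> \<le> real r"
    by (intro order.trans[OF sum_abs]) simp
  have 3: "(\<Sum>i<q * L. h (i mod L)) = real q * (real (card {i. i < L \<and> Q i}) - \<Lambda> * real L)"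
    unfolding sum_periodic by (simp add: h_def sum_of_bool_minus)
  have "(\<Sum>i<q * L + r. g i) = (\<Sum>i<q * L. g i - h (i mod L)) + (\<Sum>i<q * L. h (i mod L))
      + (\<Sum>i\<in>{q * L..<q * L + r}. g i)"
    using sum.atLeastLessThan_concat[of 0 "q * L" "q * L + r" g]
    by (simp add: sum_subtractf atLeast0LessThan)
  also have "\<bar>\<dots>\<bar> \<le> real k + \<bar>\<Sum>i<q * L. h (i mod L)\<bar> + real r"
    using 1 2 by linarith
  also have "\<bar>\<Sum>i<q * L. h (i mod L)\<bar> = real q * \<bar>real (card {i. i < L \<and> Q i}) - \<Lambda> * real L\<bar>"
    unfolding 3 by (simp add: abs_mult)
  finally show ?thesis by (simp add: g_def)
qed

text \<open>Here \<open>E\<close> is the discrepancy, block \<open>m\<close> consists of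
  \<open>\<tau> m\<close> copies of length \<open>L m\<close>, and \<open>e m\<close> is the
  relative discrepancy of one copy. The boundary cost \<open>k\<close> is absorbed because
  \<open>L m\<close> tends to infinity, and an incomplete copy because \<open>L m\<close> is small
  compared to \<open>off m\<close>.\<close>

lemma sublinear_from_blocks:
  fixes E e :: "nat \<Rightarrow> real" and off L \<tau> :: "nat \<Rightarrow> nat" and k :: real
  assumes off: "off 0 = 0" "\<And>m. off (Suc m) = off m + \<tau> m * L m"
    and pos: "\<And>m. 0 < \<tau> m" "\<And>m. 0 < L m" and k: "k \<ge> 0"
    and E: "\<And>m q r. q * L m + r \<le> \<tau> m * L m \<Longrightarrow>
      \<bar>E (off m + (q * L m + r)) - E (off m)\<bar> \<le> real (q * L m) * e m + k + real r"
    and e: "e \<longlonglongrightarrow> 0" and L: "filterlim L at_top sequentially"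
    and ratio: "(\<lambda>m. real (L m) / real (off m)) \<longlonglongrightarrow> 0"
  shows "(\<lambda>N. E N / real N) \<longlonglongrightarrow> 0"
proof (rule LIMSEQ_I)
  fix \<delta> :: real assume \<delta>: "0 < \<delta>"
  \<comment> \<open>Three quarters of \<delta> pay for the error proportional to \<open>N\<close>,
    the last one for the constant \<open>K + k\<close>.\<close>
  define \<epsilon> where "\<epsilon> = \<delta> / 4"
  have \<epsilon>: "0 < \<epsilon>" using \<delta> by (simp add: \<epsilon>_def)
  have "\<forall>\<^sub>F m in sequentially. e m < \<epsilon>" using order_tendstoD(2)[OF e \<epsilon>] .
  moreover have "\<forall>\<^sub>F m in sequentially. nat \<lceil>k / \<epsilon>\<rceil> \<le> L m"
    using L unfolding filterlim_at_top by blast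
  moreover have "\<forall>\<^sub>F m in sequentially. real (L m) / real (off m) < \<epsilon>"
    using order_tendstoD(2)[OF ratio \<epsilon>] .
  ultimately have "\<forall>\<^sub>F m in sequentially. e m < \<epsilon> \<and> nat \<lceil>k / \<epsilon>\<rceil> \<le> L m \<and>
      real (L m) / real (off m) < \<epsilon>"
    by eventually_elim simp
  then obtain M where "\<forall>m\<ge>M. e m < \<epsilon> \<and> nat \<lceil>k / \<epsilon>\<rceil> \<le> L m \<and> real (L m) / real (off m) < \<epsilon>"
    by (auto simp: eventually_sequentially)
  \<comment> \<open>Starting at \<open>Suc M\<close> excludes \<open>m = 0\<close>, where
    \<open>off m = 0\<close> and the ratio is a division by zero.\<close>
  then have M: "e m \<le> \<epsilon>" "nat \<lceil>k / \<epsilon>\<rceil> \<le> L m" "real (L m) / real (off m) < \<epsilon>" if "m \<ge> Suc M" for m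
    using that by (auto intro: less_imp_le)
  have off_less: "off m < off (Suc m)" for m using off(2)[of m] pos[of m] by simp
  have off_pos: "0 < off m" if "m \<ge> Suc M" for m
    using that off_less[of "m - 1"] by (cases m) auto
  have k_le: "k \<le> \<epsilon> * real (L m)" if "m \<ge> Suc M" for m
    using M(2)[OF that] \<epsilon> by (simp add: nat_ceiling_le_eq field_simps)
  have L_le: "real (L m) \<le> \<epsilon> * real (off m)" if "m \<ge> Suc M" for m
    using M(3)[OF that] off_pos[OF that] by (simp add: field_simps)
  define K where "K = \<bar>E (off (Suc M))\<bar>"
  \<comment> \<open>One \<epsilon> comes from \<open>e m\<close>, the other from the boundary cost
    \<open>k\<close> of each block.\<close>
  have K: "\<bar>E (off m)\<bar> \<le> K + 2 * \<epsilon> * real (off m)" if "m \<ge> Suc M" for m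
    using that
  proof (induction m rule: dec_induct)
    case base
    then show ?case using \<epsilon> by (simp add: K_def)
  next
    case (step m)
    have "\<bar>E (off (Suc m)) - E (off m)\<bar> \<le> real (\<tau> m * L m) * e m + k"
      using E[of "\<tau> m" m 0] off(2)[of m] by simp
    moreover have "real (\<tau> m * L m) * e m \<le> real (\<tau> m * L m) * \<epsilon>"
      using M(1)[of m] step by (intro mult_left_mono) auto
    moreover have "k \<le> real (\<tau> m * L m) * \<epsilon>"
    proof -
      have "L m \<le> \<tau> m * L m" using pos(1)[of m] by simp
      then have "\<epsilon> * real (L m) \<le> \<epsilon> * real (\<tau> m * L m)"
        using \<epsilon> by (intro mult_left_mono of_nat_mono) auto
      then show ?thesis using k_le[of m] step by (simp add: mult.commute)
    qed
    ultimately have "\<bar>E (off (Suc m))\<bar> \<le> \<bar>E (off m)\<bar> + 2 * \<epsilon> * real (\<tau> m * L m)"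
      by (simp add: mult.commute)
    also have "\<dots> \<le> K + 2 * \<epsilon> * real (off (Suc m))"
      using step.IH unfolding off(2) by (simp add: algebra_simps)
    finally show ?case .
  qed
  \<comment> \<open>The third \<epsilon> covers the incomplete copy, of length
    \<open>r < L m\<close>.\<close>
  have bound: "\<bar>E N\<bar> \<le> K + k + 3 * \<epsilon> * real N" if N: "N \<ge> off (Suc M)" for N
  proof -
    obtain m' where "off (Suc M + m') \<le> N" "N < off (Suc (Suc M + m'))"
      using between_consecutive[of "\<lambda>m. off (Suc M + m)" N] off_less N by auto
    then obtain m where m: "m \<ge> Suc M" "off m \<le> N" "N < off (Suc m)"
      using le_add1 by blast
    define p where "p = N - off m"
    define q where "q = p div L m"
    define r where "r = p mod L m"
    have p: "N = off m + (q * L m + r)" "q * L m + r \<le> \<tau> m * L m" "r < L m"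
      using m off(2)[of m] pos(2)[of m] by (simp_all add: p_def q_def r_def)
    have "\<bar>E N - E (off m)\<bar> \<le> real (q * L m) * e m + k + real r"
      using E[OF p(2)] p(1) by simp
    moreover have "real (q * L m) * e m \<le> \<epsilon> * real (q * L m)"
      using mult_left_mono[OF M(1)[OF m(1)] of_nat_0_le_iff[of "q * L m"]] by (simp only: mult.commute)
    moreover have "real r \<le> \<epsilon> * real (off m)"
      using L_le[OF m(1)] p(3) by linarith
    ultimately have "\<bar>E N\<bar> \<le> K + k + 3 * \<epsilon> * real (off m) + \<epsilon> * real (q * L m)"
      using K[OF m(1)] by linarith
    also have "\<dots> \<le> K + k + 3 * \<epsilon> * real (off m + q * L m)"
      using \<epsilon> by (simp add: algebra_simps)
    also have "\<dots> \<le> K + k + 3 * \<epsilon> * real N"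
      using p(1) \<epsilon> by (intro add_left_mono mult_left_mono of_nat_mono) auto
    finally show ?thesis .
  qed
  show "\<exists>no. \<forall>N\<ge>no. norm (E N / real N - 0) < \<delta>"
  proof (intro exI allI impI)
    fix N assume N: "N \<ge> max (off (Suc M)) (Suc (nat \<lceil>(K + k) / \<epsilon>\<rceil>))"
    then have "nat \<lceil>(K + k) / \<epsilon>\<rceil> < N" by simp
    then have "(K + k) / \<epsilon> < real N" by linarith
    then have "K + k < \<epsilon> * real N" using \<epsilon> by (simp add: field_simps)
    then have "\<bar>E N\<bar> < \<delta> * real N"
      using bound[of N] N by (simp add: \<epsilon>_def)
    then show "norm (E N / real N - 0) < \<delta>"
      using N by (simp add: field_simps)
  qed
qed

text \<open>One copy of \<open>C_seq (n + 1)\<close> is about \<open>e n\<close> times as long as one copy of \<open>C_seq n\<close>, so it is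
  outweighed by the \<open>t n\<close> copies of the latter.\<close>

lemma Suc_power_Suc_le:
  assumes "n \<ge> 1"
  shows "real (Suc n ^ Suc n) \<le> 2 * exp 1 * real n * real (n ^ n)"
proof -
  have "(1 + 1 / real n) ^ n \<le> exp (1 / real n) ^ n"
    by (intro power_mono) (auto intro: exp_ge_add_one_self)
  also have "\<dots> = exp 1" using assms by (simp flip: exp_of_nat_mult)
  finally have "real (Suc n) ^ n \<le> exp 1 * real n ^ n"
    using assms by (simp add: field_simps power_divide add_divide_distrib[symmetric] flip: power_mult_distrib)
  then have "real (Suc n) * real (Suc n) ^ n \<le> (2 * real n) * (exp 1 * real n ^ n)"
    using assms by (intro mult_mono) auto
  then show ?thesis by (simp add: algebra_simps)
qed

text \<open>Keeping only the last complete block gives \<open>offset t n \<ge> t n * n ^ n\<close>,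
  so the ratio is at most \<open>2 * exp 1 * (n / t n)\<close>.\<close>

lemma block_offset_ratio:
  assumes t: "\<And>n. n \<ge> 1 \<Longrightarrow> t n \<ge> 1" and lim: "(\<lambda>n. real n / real (t n)) \<longlonglongrightarrow> 0"
  shows "(\<lambda>m. real (Suc m ^ Suc m) / real (offset t m)) \<longlonglongrightarrow> 0"
proof -
  have bound: "norm (real (Suc (Suc m) ^ Suc (Suc m)) / real (offset t (Suc m)))
    \<le> 2 * exp 1 * (real (Suc m) / real (t (Suc m)))" for m
  proof -
    define n where "n = Suc m"
    have n: "n \<ge> 1" and tn: "t n \<ge> 1" using t by (auto simp: n_def)
    have "t n * n ^ n \<le> offset t n" by (simp add: n_def offset_Suc)
    then have "real (Suc n ^ Suc n) / real (offset t n) \<le> (2 * exp 1 * real n * real (n ^ n)) / real (t n * n ^ n)"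
      using Suc_power_Suc_le[OF n] n tn by (intro frac_le) (auto simp del: of_nat_mult of_nat_power)
    also have "\<dots> = 2 * exp 1 * (real n / real (t n))"
      using n by simp
    finally show ?thesis by (simp add: n_def)
  qed
  have "(\<lambda>m. 2 * exp 1 * (real (Suc m) / real (t (Suc m)))) \<longlonglongrightarrow> 2 * exp 1 * 0"
    by (intro tendsto_mult_left LIMSEQ_Suc lim)
  then have "(\<lambda>m. 2 * exp 1 * (real (Suc m) / real (t (Suc m)))) \<longlonglongrightarrow> 0"
    by (simp only: mult_zero_right)
  then have "(\<lambda>m. real (Suc (Suc m) ^ Suc (Suc m)) / real (offset t (Suc m))) \<longlonglongrightarrow> 0"
  proof (rule tendsto_0_le[where K = 1, OF _ always_eventually], intro allI)
    show "norm (real (Suc (Suc m) ^ Suc (Suc m)) / real (offset t (Suc m)))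
      \<le> norm (2 * exp 1 * (real (Suc m) / real (t (Suc m)))) * 1" for m
      using order.trans[OF bound abs_ge_self] by (simp only: mult_1_right real_norm_def)
  qed
  then show ?thesis by (rule LIMSEQ_imp_Suc[of "\<lambda>m. real (Suc m ^ Suc m) / real (offset t m)"])
qed

theorem theorem1:
  fixes t :: "nat \<Rightarrow> nat"
  assumes "\<And>n. n \<ge> 1 \<Longrightarrow> t n \<ge> 1"
    and "mono_on {1..} t"
    and "(\<lambda>n. real n / real (t n)) \<longlonglongrightarrow> 0"
  shows "completely_uniformly_distributed (\<lambda>i. L_seq t !! i)"
  unfolding completely_uniformly_distributed_def
proof (intro conjI allI impI)
  show "range (\<lambda>i. L_seq t !! i) \<subseteq> {0..<1}"
  proof (rule image_subsetI)
    fix i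
    have "offset t m < offset t (Suc m)" for m
      unfolding offset_Suc using assms(1)[of "Suc m"] by simp
    moreover have "offset t 0 \<le> i" by (simp add: offset_def)
    ultimately obtain m where m: "offset t m \<le> i" "i < offset t (Suc m)"
      by (rule between_consecutive)
    have "i - offset t m < t (Suc m) * Suc m ^ Suc m"
      using m unfolding offset_Suc by linarith
    from L_seq_snth[of t, OF assms(1) this] m(1)
    have "L_seq t !! i = C_seq (Suc m) ! ((i - offset t m) mod Suc m ^ Suc m)"
      by (simp only: le_add_diff_inverse)
    moreover have "(i - offset t m) mod Suc m ^ Suc m < length (C_seq (Suc m))"
      by (subst length_C_seq) auto
    ultimately have "L_seq t !! i \<in> set (C_seq (Suc m))"
      using nth_mem by metis
    then show "L_seq t !! i \<in> {0..<1}"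
      using de_bruijn_ford[of "Suc m" "Suc m"] by (auto simp: C_seq_def de_bruijn_def)
  qed
next
  fix k :: nat
  show "uniformly_distributed k (\<lambda>i d. L_seq t !! (i + d))"
    unfolding uniformly_distributed_def
  proof (intro allI impI)
    fix u v :: "nat \<Rightarrow> real"
    assume uv: "\<forall>d<k. 0 \<le> u d \<and> u d \<le> v d \<and> v d \<le> 1"
    define \<Lambda> where "\<Lambda> = (\<Prod>d<k. v d - u d)"
    have \<Lambda>: "0 \<le> \<Lambda>" "\<Lambda> \<le> 1"
      using uv unfolding \<Lambda>_def by (auto intro!: prod_nonneg prod_le_1 simp: diff_le_eq add_increasing2)
    \<comment> \<open>\<open>P\<close> tests a window of the actual sequence, \<open>Q n\<close> a
      cyclic window of one copy of \<open>C_seq n\<close>. They agree as long as the window stays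
      inside its block.\<close>
    define P where "P i \<longleftrightarrow> (\<forall>d<k. L_seq t !! (i + d) \<in> {u d..<v d})" for i
    define Q where "Q n i \<longleftrightarrow> (\<forall>d<k. C_seq n ! ((i + d) mod n ^ n) \<in> {u d..<v d})" for n i
    define L where "L m = Suc m ^ Suc m" for m
    define c where "c m = real (card {i. i < L m \<and> Q (Suc m) i})" for m
    define E where "E N = (\<Sum>i<N. of_bool (P i) - \<Lambda>)" for N
    have L0: "0 < L m" for m by (simp add: L_def)
    have PQ: "P (offset t m + i) = Q (Suc m) (i mod L m)" if "i + k \<le> t (Suc m) * L m" for m i
    proof -
      have "L_seq t !! (offset t m + i + d) = C_seq (Suc m) ! ((i mod L m + d) mod L m)" if "d < k" for d
        using L_seq_snth[of t "i + d" m, OF assms(1)] that \<open>i + k \<le> _\<close>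
        by (simp add: L_def add.assoc mod_simps)
      then show ?thesis by (simp add: P_def Q_def L_def)
    qed
    have "(\<lambda>N. E N / real N) \<longlonglongrightarrow> 0"
    proof (rule sublinear_from_blocks)
      show "offset t 0 = 0" by (simp add: offset_def)
      show "offset t (Suc m) = offset t m + t (Suc m) * L m" for m by (simp add: offset_Suc L_def)
      show "0 < t (Suc m)" for m using assms(1)[of "Suc m"] by simp
      show "\<bar>E (offset t m + (q * L m + r)) - E (offset t m)\<bar>
          \<le> real (q * L m) * \<bar>c m / real (L m) - \<Lambda>\<bar> + real k + real r"
        if "q * L m + r \<le> t (Suc m) * L m" for m q r
      proof -
        have "E (offset t m + (q * L m + r)) - E (offset t m)
            = (\<Sum>i<q * L m + r. of_bool (P (offset t m + i)) - \<Lambda>)"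
          unfolding E_def
          using sum.atLeastLessThan_concat[of 0 "offset t m" "offset t m + (q * L m + r)" "\<lambda>i. of_bool (P i) - \<Lambda>"]
            sum.shift_bounds_nat_ivl[of "\<lambda>i. of_bool (P i) - \<Lambda>" 0 "offset t m" "q * L m + r"]
          by (simp add: atLeast0LessThan add.commute)
        moreover have "\<bar>c m - \<Lambda> * real (L m)\<bar> = real (L m) * \<bar>c m / real (L m) - \<Lambda>\<bar>"
        proof -
          have "c m - \<Lambda> * real (L m) = real (L m) * (c m / real (L m) - \<Lambda>)"
            using L0[of m] by (simp add: field_simps)
          then show ?thesis by (simp add: abs_mult)
        qed
        ultimately show ?thesis
          using block_discrepancy[of k "t (Suc m) * L m" "\<lambda>i. P (offset t m + i)" "Q (Suc m)" "L m" \<Lambda> q r]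
            PQ \<Lambda> that by (simp add: c_def mult.assoc)
      qed
      show "(\<lambda>m. \<bar>c m / real (L m) - \<Lambda>\<bar>) \<longlonglongrightarrow> 0"
        using LIMSEQ_Suc[OF C_seq_density[OF uv]] unfolding c_def L_def Q_def \<Lambda>_def
        by (intro tendsto_rabs_zero LIM_zero)
      show "filterlim L at_top sequentially"
      proof (rule filterlim_at_top_mono[OF filterlim_Suc])
        show "\<forall>\<^sub>F m in sequentially. Suc m \<le> L m"
          unfolding L_def by (intro always_eventually allI self_le_power) auto
      qed
      show "(\<lambda>m. real (L m) / real (offset t m)) \<longlonglongrightarrow> 0"
        unfolding L_def by (rule block_offset_ratio[of t, OF assms(1,3)])
    qed (use L0 in auto)
    \<comment> \<open>The quotient is the empirical frequency minus the volume of the box.\<close>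
    moreover have "E N / real N = real (card {i. i < N \<and> P i}) / real N - \<Lambda>" if "N \<ge> 1" for N
      using that by (simp add: E_def sum_of_bool_minus field_simps)
    ultimately have "(\<lambda>N. real (card {i. i < N \<and> P i}) / real N - \<Lambda>) \<longlonglongrightarrow> 0"
      by (rule Lim_transform_eventually[OF _ eventually_sequentiallyI[of 1]])
    then show "(\<lambda>N. real (card {i. i < N \<and> (\<forall>d<k. L_seq t !! (i + d) \<in> {u d..<v d})}) / real N)
        \<longlonglongrightarrow> (\<Prod>d<k. v d - u d)"
      by (simp add: P_def \<Lambda>_def LIM_zero_iff)
  qed
qed

end
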